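(* $\mathbf{R}_s(I_1 \vdash I_2 \diamond I_3) \sqsubseteq \mathbf{while}\; b \;\mathbf{do}\; \mathbf{R}_s(Q_1 \vdash Q_2 \diamond Q_3)$ provided that: (1) $Q_3 = Q_3 \land tt > \langle\rangle$ (the contract is productive); (2) $(([b]_r \mathbin{;} Q_3)^{\star} \;\mathbf{wlp}_R\; (b \Rightarrow Q_1)) \sqsubseteq I_1$; (3) $I_2 \sqsubseteq ([b]_r \mathbin{;} Q_2)$ and $I_2 \sqsubseteq ([b]_r \mathbin{;} Q_3 \mathbin{;} I_2)$; (4) $I_3 \sqsubseteq [\neg b]_r$ and $I_3 \sqsubseteq ([b]_r \mathbin{;} Q_3 \mathbin{;} I_3)$.
   Context: $S \sqsubseteq P$ means $P$ refines $S$ (universally closed $P \Rightarrow S$). $\mathbf{R}_s(P_1 \vdash P_2 \diamond P_3)$ is a stateful-failure reactive contract with precondition $P_1$, pericondition $P_2$, postcondition $P_3$ (reactive relations over state $st, st'$, trace contribution $tt \triangleq tr'-tr$, and refusals $ref'$); $I_2$ and $I_3$ are reactive invariants for quiescent and final observations. The reactive while loop is $\mathbf{while}\; b \;\mathbf{do}\; P \triangleq \mu X \bullet (P \mathbin{;} X) \triangleleft b \triangleright \mathbf{Skip}$ (weakest fixed point). $[b]_r \triangleq \Phi(b, id, \langle\rangle)$ is a reactive relational test, where $\Phi(s,\sigma,t) \triangleq \exists ref \bullet \mathbf{RR}(s \land st' = \sigma(st) \land tt = t)$. The star on reactive relations is $Q^{\star} \triangleq \mathrm{II}_c \sqcap \bigvee_{i\in\mathbb{N}}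 Q^{i+1}$ with $\mathrm{II}_c \triangleq (st'=st \land tr'=tr)$, $\sqcap$ being disjunction and $Q^{i}$ the $i$-fold sequential composition $\mathbin{;}$. $P \;\mathbf{wlp}_R\; Q \triangleq \neg_r(P \mathbin{;} \neg_r Q)$ with $\neg_r P \triangleq \neg P \land tr \le tr'$. *)

theory Defs
  imports Main "HOL-Library.Prefix_Order"
begin

text \<open>Events have type \<open>'e\<close> and states type \<open>'s\<close>. Traces are event lists; by
  \<open>Prefix_Order\<close>, \<open>\<le>\<close> on lists is the prefix order. A relation relates the unprimed observation
  (first argument) to the primed one (second argument).\<close>

record ('s, 'e) obs =
  ok :: bool
  wait :: bool
  tr :: "'e list"
  st :: 's
  ref :: "'e set"

type_synonym ('s, 'e) rel = "('s, 'e) obs \<Rightarrow> ('s, 'e) obs \<Rightarrow> bool"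

definition refines :: "('s, 'e) rel \<Rightarrow> ('s, 'e) rel \<Rightarrow> bool" (infix "\<sqsubseteq>" 50) where
  "S \<sqsubseteq> P \<longleftrightarrow> (\<forall>x y. P x y \<longrightarrow> S x y)"

abbreviation seqr :: "('s, 'e) rel \<Rightarrow> ('s, 'e) rel \<Rightarrow> ('s, 'e) rel" (infixr ";;" 71) where
  "P ;; Q \<equiv> P OO Q"

text \<open>The trace contribution \<open>tr' - tr\<close>; it is meaningful only where \<open>tr \<le> tr'\<close>.\<close>

definition tt :: "('s, 'e) obs \<Rightarrow> ('s, 'e) obs \<Rightarrow> 'e list" where
  "tt x y = drop (length (tr x)) (tr y)"


subsection \<open>Reactive relations and conditions\<close>

definition R1 :: "('s, 'e) rel \<Rightarrow> ('s, 'e) rel" where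
  "R1 P = (\<lambda>x y. P x y \<and> tr x \<le> tr y)"

definition R2c :: "('s, 'e) rel \<Rightarrow> ('s, 'e) rel" where
  "R2c P = (\<lambda>x y. if tr x \<le> tr y then P (x\<lparr>tr := []\<rparr>) (y\<lparr>tr := tt x y\<rparr>) else P x y)"

definition RR :: "('s, 'e) rel \<Rightarrow> ('s, 'e) rel" where
  "RR P = (\<lambda>x y. \<exists>k w k' w'. R1 (R2c P) (x\<lparr>ok := k, wait := w\<rparr>) (y\<lparr>ok := k', wait := w'\<rparr>))"

definition true_r :: "('s, 'e) rel" where
  "true_r = R1 (\<lambda>x y. True)"

definition not_r :: "('s, 'e) rel \<Rightarrow> ('s, 'e) rel" ("\<not>\<^sub>r _" [75] 75) where
  "\<not>\<^sub>r P = (\<lambda>x y. \<not> P x y \<and> tr x \<le> tr y)"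

definition RC1 :: "('s, 'e) rel \<Rightarrow> ('s, 'e) rel" where
  "RC1 P = \<not>\<^sub>r ((\<not>\<^sub>r P) ;; true_r)"

definition RC :: "('s, 'e) rel \<Rightarrow> ('s, 'e) rel" where
  "RC P = RC1 (RR P)"

text \<open>Stateful-failure relations and conditions additionally do not depend on the unprimed
  refusal set.\<close>

definition CRR :: "('s, 'e) rel \<Rightarrow> ('s, 'e) rel" where
  "CRR P = (\<lambda>x y. \<exists>r. RR P (x\<lparr>ref := r\<rparr>) y)"

definition CRC :: "('s, 'e) rel \<Rightarrow> ('s, 'e) rel" where
  "CRC P = (\<lambda>x y. \<exists>r. RC P (x\<lparr>ref := r\<rparr>) y)"

definition no_st' :: "('s, 'e) rel \<Rightarrow> bool" where
  "no_st' P \<longleftrightarrow> (\<forall>x y s. P x (y\<lparr>st := s\<rparr>) = P x y)"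

definition no_ref' :: "('s, 'e) rel \<Rightarrow> bool" where
  "no_ref' P \<longleftrightarrow> (\<forall>x y r. P x (y\<lparr>ref := r\<rparr>) = P x y)"

definition \<Phi> :: "('s \<Rightarrow> bool) \<Rightarrow> ('s \<Rightarrow> 's) \<Rightarrow> ('s \<Rightarrow> 'e list) \<Rightarrow> ('s, 'e) rel" where
  "\<Phi> s \<sigma> t = (\<lambda>x y. \<exists>r. RR (\<lambda>x y. s (st x) \<and> st y = \<sigma> (st x) \<and> tt x y = t (st x)) (x\<lparr>ref := r\<rparr>) y)"

definition test_r :: "('s \<Rightarrow> bool) \<Rightarrow> ('s, 'e) rel" ("[_]\<^sub>r") where
  "[b]\<^sub>r = \<Phi> b id (\<lambda>s. [])"

definition II_c :: "('s, 'e) rel" where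
  "II_c = (\<lambda>x y. st y = st x \<and> tr y = tr x)"

definition star_r :: "('s, 'e) rel \<Rightarrow> ('s, 'e) rel" ("_\<^sup>\<star>" [1000] 1000) where
  "Q\<^sup>\<star> = (\<lambda>x y. II_c x y \<or> (\<exists>i. (Q ^^ (i + 1)) x y))"

definition wlp_r :: "('s, 'e) rel \<Rightarrow> ('s, 'e) rel \<Rightarrow> ('s, 'e) rel" (infix "wlp\<^sub>R" 65) where
  "P wlp\<^sub>R Q = \<not>\<^sub>r (P ;; \<not>\<^sub>r Q)"


subsection \<open>Reactive contracts\<close>

definition design :: "('s, 'e) rel \<Rightarrow> ('s, 'e) rel \<Rightarrow> ('s, 'e) rel" (infix "\<turnstile>" 60) where
  "P \<turnstile> Q = (\<lambda>x y. ok x \<and> P x y \<longrightarrow> ok y \<and> Q x y)"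

definition peri_post :: "('s, 'e) rel \<Rightarrow> ('s, 'e) rel \<Rightarrow> ('s, 'e) rel" (infix "\<diamondop>" 62) where
  "P \<diamondop> Q = (\<lambda>x y. if wait y then P x y else Q x y)"

definition II_R :: "('s, 'e) rel" where
  "II_R = (\<lambda>x y. x = y \<or> \<not> ok x \<and> tr x \<le> tr y)"

text \<open>While a predecessor is waiting, its state is hidden.\<close>

definition R3h :: "('s, 'e) rel \<Rightarrow> ('s, 'e) rel" where
  "R3h P = (\<lambda>x y. if wait x then \<exists>s. II_R (x\<lparr>st := s\<rparr>) y else P x y)"

definition Rs :: "('s, 'e) rel \<Rightarrow> ('s, 'e) rel" ("\<^bold>R\<^sub>s") where
  "\<^bold>R\<^sub>s P = R1 (R2c (R3h P))"

definition sf_contract :: "('s, 'e) rel \<Rightarrow> ('s, 'e) rel \<Rightarrow> ('s, 'e) rel \<Rightarrow> bool" where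
  "sf_contract P\<^sub>1 P\<^sub>2 P\<^sub>3 \<longleftrightarrow>
     CRC P\<^sub>1 = P\<^sub>1 \<and> CRR P\<^sub>2 = P\<^sub>2 \<and> no_st' P\<^sub>2 \<and> CRR P\<^sub>3 = P\<^sub>3 \<and> no_ref' P\<^sub>3"

definition sf_contracts :: "('s, 'e) rel set" where
  "sf_contracts = {\<^bold>R\<^sub>s (P\<^sub>1 \<turnstile> P\<^sub>2 \<diamondop> P\<^sub>3) | P\<^sub>1 P\<^sub>2 P\<^sub>3. sf_contract P\<^sub>1 P\<^sub>2 P\<^sub>3}"

definition Skip :: "('s, 'e) rel" where
  "Skip = \<^bold>R\<^sub>s (true_r \<turnstile> (\<lambda>x y. False) \<diamondop> \<Phi> (\<lambda>s. True) id (\<lambda>s. []))"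


subsection \<open>Weakest fixed points and iteration\<close>

text \<open>The complete lattice of contracts is ordered by \<open>\<sqsubseteq>\<close>, so the greatest lower bound of a
  nonempty set of contracts is its disjunction. The set below contains the miraculous contract,
  hence is nonempty, and this is the Knaster-Tarski weakest fixed point. Forming it in the lattice
  of contracts, rather than of all relations, matters: the weakest fixed point among all relations
  need not be healthy.\<close>

definition mu_sf :: "(('s, 'e) rel \<Rightarrow> ('s, 'e) rel) \<Rightarrow> ('s, 'e) rel" where
  "mu_sf F = (\<lambda>x y. \<exists>X. X \<in> sf_contracts \<and> F X \<sqsubseteq> X \<and> X x y)"

definition cond_st :: "('s, 'e) rel \<Rightarrow> ('s \<Rightarrow> bool) \<Rightarrow> ('s, 'e) rel \<Rightarrow> ('s, 'e) rel"
    ("(_ \<triangleleft> _ \<triangleright> _)" [52, 0, 53] 52) where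
  "P \<triangleleft> b \<triangleright> Q = (\<lambda>x y. if b (st x) then P x y else Q x y)"

definition while_sf :: "('s \<Rightarrow> bool) \<Rightarrow> ('s, 'e) rel \<Rightarrow> ('s, 'e) rel" ("(while _ do _)" [0, 60] 60) where
  "while b do P = mu_sf (\<lambda>X. (P ;; X) \<triangleleft> b \<triangleright> Skip)"

end

theory Submission
  imports Defs
begin

text \<open>Every disjunct \<open>X\<close> of the weakest fixed point is a contract with \<open>F X \<sqsubseteq> X\<close>, so each of its
  observations unfolds into a \<open>Skip\<close> with the guard false, or into one run of the body followed
  by a shorter observation of \<open>X\<close>: by productivity the body consumes a nonempty part of the trace.
  Hence the claim follows by induction on the length of the trace contribution. \<open>I\<^sub>1\<close> itself is not
  preserved by the unfolding; what is preserved is that \<open>Q\<^sub>1\<close> holds at every state that iterations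
  of the body can reach within the observed trace.\<close>

lemma list_le_iff_append: "(xs :: 'a list) \<le> ys \<longleftrightarrow> (\<exists>zs. ys = xs @ zs)"
  by (auto simp: less_eq_list_def prefix_def)

lemma tt_less_add:
  assumes "tr x \<le> tr z" "tr z \<le> tr y" "tt x z > []"
  shows "length (tt z y) < length (tt x y)"
  using assms by (auto simp: list_le_iff_append tt_def)

text \<open>Beyond \<open>tr x \<le> tr y\<close>, the right-hand side reads only
  \<open>st x\<close>, \<open>st y\<close>, \<open>ref y\<close> and \<open>tt x y\<close>: a
  healthy relation cannot distinguish observations that agree on these.\<close>

lemma CRR_iff:
  assumes "CRR P = P"
  shows "P x y \<longleftrightarrow> tr x \<le> tr y \<and>
    (\<exists>r k w k' w'. P (x\<lparr>tr := [], ref := r, ok := k, wait := w\<rparr>) (y\<lparr>tr := tt x y, ok := k', wait := w'\<rparr>))"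
  by (cases x; cases y; cases "tr x \<le> tr y"; subst assms [symmetric])
    (simp_all add: CRR_def RR_def R1_def R2c_def tt_def)

lemma CRR_shift:
  assumes "CRR P = P" "tr x \<le> tr y"
  shows "P (x\<lparr>tr := []\<rparr>) (y\<lparr>tr := tt x y\<rparr>) \<longleftrightarrow> P x y"
  using assms(2)
  by (subst (1 2) CRR_iff [OF assms(1)]) (simp add: tt_def)

lemma RR_shift:
  assumes "tr x \<le> tr y"
  shows "RR P (x\<lparr>tr := []\<rparr>) (y\<lparr>tr := tt x y\<rparr>) \<longleftrightarrow> RR P x y"
  using assms by (cases x; cases y) (simp add: RR_def R1_def R2c_def tt_def)

text \<open>The two negations in \<open>RC1\<close> become a universal quantifier over all
  \<open>z\<close> whose trace lies between those of \<open>x\<close> and \<open>y\<close>. So only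
  the trace of \<open>y\<close> matters, and shortening it keeps the condition true.\<close>

lemma CRC_iff:
  "CRC P x y \<longleftrightarrow> tr x \<le> tr y \<and>
    (\<exists>r. \<forall>z. tr x \<le> tr z \<and> tr z \<le> tr y \<longrightarrow> RR P (x\<lparr>ref := r\<rparr>) z)"
  by (auto simp: CRC_def RC_def RC1_def not_r_def true_r_def R1_def OO_def)

lemma CRC_prefix:
  assumes "CRC P = P" "P x y" "tr x \<le> tr z" "tr z \<le> tr y"
  shows "P x z"
proof -
  have "CRC P x y"
    using assms by simp
  then have "CRC P x z"
    using assms(3,4) unfolding CRC_iff by (meson order_trans)
  then show ?thesis
    using assms by simp
qed

text \<open>The shift is carried out on the intermediate observations of \<open>CRC_iff\<close>:
  removing or prepending \<open>tr x\<close> matches the two ranges of \<open>z\<close>.\<close>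

lemma CRC_shift:
  assumes "CRC P = P" "tr x \<le> tr y"
  shows "P (x\<lparr>tr := []\<rparr>) (y\<lparr>tr := tt x y\<rparr>) \<longleftrightarrow> P x y"
proof -
  have comm: "x\<lparr>tr := [], ref := r\<rparr> = x\<lparr>ref := r, tr := []\<rparr>" for r
    by simp
  have "(\<forall>z. tr z \<le> tt x y \<longrightarrow> RR P (x\<lparr>tr := [], ref := r\<rparr>) z) \<longleftrightarrow>
        (\<forall>z. tr x \<le> tr z \<and> tr z \<le> tr y \<longrightarrow> RR P (x\<lparr>ref := r\<rparr>) z)" (is "?L \<longleftrightarrow> ?R") for r
  proof (intro iffI allI impI)
    fix z :: "('a, 'b) obs"
    assume ?L and z: "tr x \<le> tr z \<and> tr z \<le> tr y"
    then have "RR P (x\<lparr>tr := [], ref := r\<rparr>) (z\<lparr>tr := tt x z\<rparr>)"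
      by (auto simp: list_le_iff_append tt_def)
    then show "RR P (x\<lparr>ref := r\<rparr>) z"
      using RR_shift [of "x\<lparr>ref := r\<rparr>" z P] z by (simp add: comm tt_def)
  next
    fix z :: "('a, 'b) obs"
    assume ?R and z: "tr z \<le> tt x y"
    then have "RR P (x\<lparr>ref := r\<rparr>) (z\<lparr>tr := tr x @ tr z\<rparr>)"
      using assms(2) by (auto simp: list_le_iff_append tt_def)
    then show "RR P (x\<lparr>tr := [], ref := r\<rparr>) z"
      using RR_shift [of "x\<lparr>ref := r\<rparr>" "z\<lparr>tr := tr x @ tr z\<rparr>" P]
      by (simp add: comm tt_def list_le_iff_append)
  qed
  then have "CRC P (x\<lparr>tr := []\<rparr>) (y\<lparr>tr := tt x y\<rparr>) \<longleftrightarrow> CRC P x y"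
    using assms(2) by (simp add: CRC_iff)
  then show ?thesis
    using assms(1) by simp
qed

lemma Rs_tr_le: "\<^bold>R\<^sub>s D x y \<Longrightarrow> tr x \<le> tr y"
  by (simp add: Rs_def R1_def)

text \<open>For a waiting input \<open>R3h\<close> discards \<open>D\<close>, so all contracts agree
  there; if \<open>ok x\<close> also holds, only the state can change.\<close>

lemma Rs_waiting:
  assumes "wait x"
  shows "\<^bold>R\<^sub>s D x y \<longleftrightarrow> tr x \<le> tr y \<and> (ok x \<longrightarrow> (\<exists>s. y = x\<lparr>st := s\<rparr>))"
proof -
  have "x\<lparr>tr := [], st := s\<rparr> = y\<lparr>tr := tt x y\<rparr> \<longleftrightarrow> y = x\<lparr>st := s\<rparr>" if "tr x \<le> tr y" for s
    using that by (cases x; cases y) (auto simp: tt_def list_le_iff_append)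
  then show ?thesis
    using assms by (auto simp: Rs_def R1_def R2c_def R3h_def II_R_def)
qed

text \<open>Healthiness makes each component invariant under trace shifts, so \<open>R2c\<close>
  disappears.\<close>

lemma Rs_contract:
  assumes "sf_contract P\<^sub>1 P\<^sub>2 P\<^sub>3" "\<not> wait x"
  shows "\<^bold>R\<^sub>s (P\<^sub>1 \<turnstile> P\<^sub>2 \<diamondop> P\<^sub>3) x y \<longleftrightarrow>
    tr x \<le> tr y \<and> (ok x \<and> P\<^sub>1 x y \<longrightarrow> ok y \<and> (if wait y then P\<^sub>2 x y else P\<^sub>3 x y))"
  using assms CRC_shift [of P\<^sub>1 x y] CRR_shift [of P\<^sub>2 x y] CRR_shift [of P\<^sub>3 x y]
  by (auto simp: sf_contract_def Rs_def R1_def R2c_def R3h_def design_def peri_post_def)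

lemma test_r_iff: "[b]\<^sub>r x y \<longleftrightarrow> b (st x) \<and> st y = st x \<and> tr y = tr x"
  by (auto simp: test_r_def \<Phi>_def RR_def R1_def R2c_def tt_def list_le_iff_append)

lemma Skip_iff:
  assumes "ok x" "\<not> wait x"
  shows "Skip x y \<longleftrightarrow> ok y \<and> \<not> wait y \<and> st y = st x \<and> tr y = tr x"
  using assms
  by (auto simp: Skip_def Rs_def R1_def R2c_def R3h_def design_def peri_post_def true_r_def
      \<Phi>_def RR_def tt_def list_le_iff_append)

text \<open>Zero iterations are covered because \<open>II_c\<close> contains equality, and
  \<open>Suc n\<close> iterations are the disjunct with \<open>i = n\<close>.\<close>

lemma wlp_star_rtranclp:
  assumes "(Q\<^sup>\<star> wlp\<^sub>R P) x y" "Q\<^sup>*\<^sup>* x z" "tr z \<le> tr y"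
  shows "P z y"
proof -
  have "Q\<^sup>\<star> x z"
  proof -
    obtain n where "(Q ^^ n) x z"
      using assms(2) by (auto simp: rtranclp_power)
    then show ?thesis
      by (cases n) (auto simp: star_r_def II_c_def)
  qed
  then show ?thesis
    using assms(1,3) by (auto simp: wlp_r_def not_r_def)
qed

theorem theorem26:
  fixes b :: "'s \<Rightarrow> bool"
    and Q\<^sub>1 Q\<^sub>2 Q\<^sub>3 I\<^sub>1 I\<^sub>2 I\<^sub>3 :: "('s, 'e) rel"
  assumes contract_Q: "sf_contract Q\<^sub>1 Q\<^sub>2 Q\<^sub>3"
    and contract_I: "sf_contract I\<^sub>1 I\<^sub>2 I\<^sub>3"
    and productive: "Q\<^sub>3 = (\<lambda>x y. Q\<^sub>3 x y \<and> tt x y > [])"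
    and pre: "(([b]\<^sub>r ;; Q\<^sub>3)\<^sup>\<star> wlp\<^sub>R (\<lambda>x y. b (st x) \<longrightarrow> Q\<^sub>1 x y)) \<sqsubseteq> I\<^sub>1"
    and peri: "I\<^sub>2 \<sqsubseteq> [b]\<^sub>r ;; Q\<^sub>2" "I\<^sub>2 \<sqsubseteq> [b]\<^sub>r ;; Q\<^sub>3 ;; I\<^sub>2"
    and post: "I\<^sub>3 \<sqsubseteq> [\<lambda>s. \<not> b s]\<^sub>r" "I\<^sub>3 \<sqsubseteq> [b]\<^sub>r ;; Q\<^sub>3 ;; I\<^sub>3"
  shows "\<^bold>R\<^sub>s (I\<^sub>1 \<turnstile> I\<^sub>2 \<diamondop> I\<^sub>3) \<sqsubseteq> while b do \<^bold>R\<^sub>s (Q\<^sub>1 \<turnstile> Q\<^sub>2 \<diamondop> Q\<^sub>3)"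
proof -
  let ?F = "\<lambda>X. (\<^bold>R\<^sub>s (Q\<^sub>1 \<turnstile> Q\<^sub>2 \<diamondop> Q\<^sub>3) ;; X) \<triangleleft> b \<triangleright> Skip"
  let ?B = "[b]\<^sub>r ;; Q\<^sub>3"
  have Q: "CRC Q\<^sub>1 = Q\<^sub>1" "no_st' Q\<^sub>2" "CRR Q\<^sub>3 = Q\<^sub>3"
    using contract_Q by (auto simp: sf_contract_def)
  \<comment> \<open>The test leaves \<open>ok\<close>, \<open>wait\<close> and \<open>ref\<close>
    free, so \<open>x\<close> itself serves as the intermediate observation.\<close>
  have test: "([b]\<^sub>r ;; R) x y" if "b (st x)" "R x y" for R :: "('s, 'e) rel" and x y
    using that by (auto simp: test_r_iff)
  have step: "ok y \<and> (if wait y then I\<^sub>2 x y else I\<^sub>3 x y)"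
    if X: "X \<in> sf_contracts" "?F X \<sqsubseteq> X"
      and "X x y" "ok x" "\<not> wait x"
      and "\<forall>z. ?B\<^sup>*\<^sup>* x z \<and> tr z \<le> tr y \<and> b (st z) \<longrightarrow> Q\<^sub>1 z y"
    for X x y
    \<comment> \<open>Only the facts about \<open>x\<close> enter the induction: \<open>X\<close>
      and \<open>y\<close> stay fixed while \<open>x\<close> advances along the trace.\<close>
    using that(3-)
  proof (induction "length (tt x y)" arbitrary: x rule: less_induct)
    case (less x)
    have unfold: "?F X x y"
      using X(2) less.prems(1) by (auto simp: refines_def)
    obtain D where D: "X = \<^bold>R\<^sub>s D"
      using X(1) by (auto simp: sf_contracts_def)
    show ?case
    proof (cases "b (st x)")
      case False
      then have "ok y" "\<not> wait y" "[\<lambda>s. \<not> b s]\<^sub>r x y"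
        using unfold less.prems by (auto simp: cond_st_def Skip_iff test_r_iff)
      then show ?thesis
        using post(1) by (auto simp: refines_def)
    next
      case True
      then obtain z where z: "\<^bold>R\<^sub>s (Q\<^sub>1 \<turnstile> Q\<^sub>2 \<diamondop> Q\<^sub>3) x z" "X z y"
        using unfold by (auto simp: cond_st_def)
      have tr: "tr x \<le> tr z" "tr z \<le> tr y"
        using z D by (auto dest: Rs_tr_le)
      \<comment> \<open>Zero iterations reach \<open>x\<close> itself.\<close>
      have "Q\<^sub>1 x y"
        using less.prems True tr by (meson order_trans rtranclp.rtrancl_refl)
      \<comment> \<open>The precondition is known up to \<open>y\<close>, but the body stops at
        \<open>z\<close>, whose trace is a prefix.\<close>
      then have "Q\<^sub>1 x z"
        using CRC_prefix Q(1) tr by blast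
      then have body: "ok z" "if wait z then Q\<^sub>2 x z else Q\<^sub>3 x z"
        using z(1) less.prems Rs_contract [OF contract_Q] by auto
      show ?thesis
      proof (cases "wait z")
        case True
        \<comment> \<open>\<open>X\<close> passes a waiting \<open>z\<close> on with at most its
          state altered, and \<open>Q\<^sub>2\<close> ignores the final state.\<close>
        then obtain s where s: "y = z\<lparr>st := s\<rparr>"
          using z(2) D body(1) by (auto simp: Rs_waiting)
        then have "Q\<^sub>2 x y"
          using body(2) True Q(2) by (simp add: no_st'_def)
        then have "I\<^sub>2 x y"
          using test [OF \<open>b (st x)\<close>] peri(1) by (auto simp: refines_def)
        then show ?thesis
          using s body(1) True by simp
      next
        case False
        then have Q3: "Q\<^sub>3 x z"
          using body(2) by simp
        then have "tt x z > []"
          using productive by metis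
        then have shorter: "length (tt z y) < length (tt x y)"
          using tt_less_add tr by blast
        have "?B x z"
          using test True Q3 by blast
        \<comment> \<open>Whatever is reachable from \<open>z\<close> is reachable from
          \<open>x\<close> through one more iteration of the body.\<close>
        then have "\<forall>z'. ?B\<^sup>*\<^sup>* z z' \<and> tr z' \<le> tr y \<and> b (st z') \<longrightarrow> Q\<^sub>1 z' y"
          using less.prems(4) by (meson converse_rtranclp_into_rtranclp)
        then have IH: "ok y" "if wait y then I\<^sub>2 z y else I\<^sub>3 z y"
          using less.hyps [OF shorter z(2) body(1) False] by auto
        have "I\<^sub>2 x y" if "I\<^sub>2 z y"
          using peri(2) test [OF True, of "Q\<^sub>3 ;; I\<^sub>2"] Q3 that unfolding refines_def by blast
        moreover have "I\<^sub>3 x y" if "I\<^sub>3 z y"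
          using post(2) test [OF True, of "Q\<^sub>3 ;; I\<^sub>3"] Q3 that unfolding refines_def by blast
        ultimately show ?thesis
          using IH by simp
      qed
    qed
  qed
  have "\<^bold>R\<^sub>s (I\<^sub>1 \<turnstile> I\<^sub>2 \<diamondop> I\<^sub>3) x y"
    if X: "X \<in> sf_contracts" "?F X \<sqsubseteq> X" "X x y" for X x y
  proof -
    obtain D where D: "X = \<^bold>R\<^sub>s D"
      using X(1) by (auto simp: sf_contracts_def)
    show ?thesis
    proof (cases "wait x")
      case True
      \<comment> \<open>On waiting inputs the invariant contract and \<open>X\<close>
        coincide.\<close>
      then show ?thesis
        using X(3) D by (simp add: Rs_waiting)
    next
      case False
      have "ok y \<and> (if wait y then I\<^sub>2 x y else I\<^sub>3 x y)" if "ok x" "I\<^sub>1 x y"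
      proof -
        have "(?B\<^sup>\<star> wlp\<^sub>R (\<lambda>x y. b (st x) \<longrightarrow> Q\<^sub>1 x y)) x y"
          using pre that(2) by (auto simp: refines_def)
        then have "\<forall>z. ?B\<^sup>*\<^sup>* x z \<and> tr z \<le> tr y \<and> b (st z) \<longrightarrow> Q\<^sub>1 z y"
          using wlp_star_rtranclp by blast
        then show ?thesis
          using step X that(1) False by blast
      qed
      then show ?thesis
        using Rs_contract [OF contract_I False] Rs_tr_le X(3) D by blast
    qed
  qed
  then show ?thesis
    by (auto simp: refines_def while_sf_def mu_sf_def)
qed

end
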